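(* For $n, m \in \mathbb{N}$, let $kr_1(n,m)$ be the number of partitions $\lambda_1 \le \lambda_2 \le \cdots \le \lambda_m$ of $n$ into $m$ parts with difference at least three at distance two such that if two successive parts differ by at most one, then their sum is divisible by $3$. Then $$\sum_{n, m \geq 0} kr_1(n, m)\, q^n x^m = \sum_{n_1, n_2 \geq 0} \frac{ q^{3n_2^2 + n_1^2 + 3n_1n_2}\, x^{2n_2 + n_1} }{ (q; q)_{n_1} (q^3; q^3)_{n_2} }.$$
   Context: $\mathbb{N}=\{0,1,2,\dots\}$. A partition of $n$ into $m$ parts is a non-decreasing sequence $\lambda_1 \le \cdots \le \lambda_m$ of positive integers with sum $n$ (the empty partition is the unique partition of $0$, with $m=0$). "Difference at least $k$ at distance $d$" means $\lambda_{j+d}-\lambda_j \ge k$ for all $1 \le j \le m-d$. "Successive parts" are $\lambda_j$ and $\lambda_{j+1}$. The $q$-Pochhammer symbol is $(a;q)_n = \prod_{j=1}^{n}(1-aq^{j-1})$, with $(a;q)_0=1$. The identity is one of formal power series in $q$ and $x$. *)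

theory Defs
  imports "HOL-Analysis.Analysis"
begin

text \<open>
  Partitions are non-decreasing lists of positive integers. Lists are indexed from 0,
  so the part \<open>\<lambda>\<^sub>j\<close> is \<open>xs ! (j - 1)\<close>.
\<close>

definition partitions_of :: "nat \<Rightarrow> nat \<Rightarrow> nat list set" where
  "partitions_of n m =
     {xs. sorted xs \<and> (\<forall>a\<in>set xs. 0 < a) \<and> sum_list xs = n \<and> length xs = m}"

definition diff_at_distance :: "nat \<Rightarrow> nat \<Rightarrow> nat list \<Rightarrow> bool" where
  "diff_at_distance k d xs \<longleftrightarrow> (\<forall>j. j + d < length xs \<longrightarrow> xs ! (j + d) \<ge> xs ! j + k)"

definition kr1_partitions :: "nat \<Rightarrow> nat \<Rightarrow> nat list set" where
  "kr1_partitions n m =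
     {xs \<in> partitions_of n m. diff_at_distance 3 2 xs \<and>
        (\<forall>j. j + 1 < length xs \<longrightarrow> xs ! (j + 1) \<le> xs ! j + 1 \<longrightarrow> 3 dvd (xs ! j + xs ! (j + 1)))}"

lemma finite_kr1_partitions: "finite (kr1_partitions n m)"
proof (rule finite_subset)
  show "kr1_partitions n m \<subseteq> {xs. set xs \<subseteq> {..n} \<and> length xs = m}"
    by (auto simp: kr1_partitions_def partitions_of_def intro: member_le_sum_list)
  show "finite {xs. set xs \<subseteq> {..n} \<and> length xs = m}"
    by (rule finite_lists_length_eq) simp
qed

definition kr1 :: "nat \<Rightarrow> nat \<Rightarrow> nat" where
  "kr1 n m = card (kr1_partitions n m)"

definition qpochhammer :: "'a::comm_ring_1 \<Rightarrow> 'a \<Rightarrow> nat \<Rightarrow> 'a" where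
  "qpochhammer a q n = (\<Prod>j=1..n. 1 - a * q ^ (j - 1))"

text \<open>
  Power series in \<open>q\<close> and \<open>x\<close> are elements of \<^typ>\<open>rat fps fps\<close>: the outer variable is \<open>x\<close>
  and the coefficients are power series in \<open>q\<close>. Coefficients in \<open>q\<close> alone are embedded by
  \<^const>\<open>fps_const\<close>. Infinite sums are taken in the library's metric on \<open>fps\<close>, i.e. \<open>x\<close>-adically.
\<close>

abbreviation q_var :: "rat fps" where
  "q_var \<equiv> fps_X"

abbreviation x_var :: "rat fps fps" where
  "x_var \<equiv> fps_X"

end

theory Submission
  imports Defs
begin

text \<open>
  Both sides of the identity satisfy the same linear system of functional equations in \<open>x\<close>, and
  that system has only one solution with a given constant term.

  Let \<open>F\<^sub>i(x)\<close> be the generating function of the admissible partitions all of whose parts exceed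
  \<open>i\<close>. Adding \<open>3\<close> to every part preserves admissibility, since the divisibility condition concerns
  sums of two parts; hence \<open>F\<^sub>i\<^sub>+\<^sub>3(x) = F\<^sub>i(xq\<^sup>3)\<close>. Removing the smallest part when it is
  \<open>1\<close>, \<open>2\<close> or \<open>3\<close>, together with its successor when the two are close, gives
  \<open>F\<^sub>0 = F\<^sub>1 + xq (F\<^sub>3 + xq\<^sup>2 F\<^sub>3 + xq\<^sup>3 F\<^sub>4)\<close>,
  \<open>F\<^sub>1 = F\<^sub>2 + xq\<^sup>2 F\<^sub>3\<close> and
  \<open>F\<^sub>2 = F\<^sub>3 + xq\<^sup>3 (F\<^sub>4 + xq\<^sup>3 F\<^sub>5)\<close>
  (\<open>kr1_system_list_gf\<close>). With \<open>F\<^sub>3, F\<^sub>4, F\<^sub>5\<close> replaced by the dilated series, this is a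
  closed system for \<open>F\<^sub>0, F\<^sub>1, F\<^sub>2\<close>. Modulo terms that involve lower powers of \<open>x\<close> it says
  \<open>F\<^sub>0(x) = F\<^sub>0(xq\<^sup>3)\<close>, so comparing coefficients of \<open>x\<^sup>m\<close> and cancelling \<open>1 - q\<^sup>3\<^sup>m\<close>
  determines the solution from its constant term (\<open>kr1_system_unique\<close>).

  On the other side, let \<open>S(a, b)\<close> be the double sum with the extra factor
  \<open>q^(a n\<^sub>1 + b n\<^sub>2)\<close>. Dilation takes \<open>S(a, b)\<close> to \<open>S(a + 3, b + 6)\<close>. The differences
  \<open>S(a, b) - S(a + 1, b)\<close> and \<open>S(a, b) - S(a, b + 3)\<close> introduce the factors \<open>1 - q^n\<^sub>1\<close> and
  \<open>1 - q^(3 n\<^sub>2)\<close>, which cancel the last factor of a Pochhammer symbol; shifting the summation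
  index then turns each of them into a monomial times a single series \<open>S\<close> (\<open>kr1_series_1\<close>, \<open>kr1_series_2\<close>). Five
  instances of these two rules show that \<open>S(0, 0), S(1, 3), S(2, 3)\<close> solve the system
  (\<open>kr1_system_kr1_series\<close>).
\<close>

unbundle no vec_syntax
unbundle fps_syntax

section \<open>Admissible partitions and their smallest part\<close>

text \<open>
  The two conditions on a partition as a recursion on the list, so that prepending a part can be
  analysed by looking at the first three parts only.
\<close>
fun kr1_list :: "nat list \<Rightarrow> bool" where
  "kr1_list [] \<longleftrightarrow> True"
| "kr1_list [a] \<longleftrightarrow> True"
| "kr1_list (a # b # xs) \<longleftrightarrow> a \<le> b \<and> (b \<le> a + 1 \<longrightarrow> 3 dvd (a + b)) \<and>
     (xs \<noteq> [] \<longrightarrow> a + 3 \<le> hd xs) \<and> kr1_list (b # xs)"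

lemma all_nat_Suc: "(\<forall>j::nat. P j) \<longleftrightarrow> P 0 \<and> (\<forall>j. P (Suc j))"
  by (metis nat.exhaust)

lemma kr1_list_iff_conditions:
  "kr1_list xs \<longleftrightarrow> sorted xs \<and> diff_at_distance 3 2 xs \<and>
     (\<forall>j. j + 1 < length xs \<longrightarrow> xs ! (j + 1) \<le> xs ! j + 1 \<longrightarrow> 3 dvd (xs ! j + xs ! (j + 1)))"
proof (induction xs rule: kr1_list.induct)
  case (3 a b xs)
  have d: "diff_at_distance 3 2 (a # b # xs) \<longleftrightarrow>
      (xs \<noteq> [] \<longrightarrow> a + 3 \<le> hd xs) \<and> diff_at_distance 3 2 (b # xs)"
    unfolding diff_at_distance_def by (subst all_nat_Suc) (cases xs; simp)
  have g: "(\<forall>j. j + 1 < length (a # b # xs) \<longrightarrow> (a # b # xs) ! (j + 1) \<le> (a # b # xs) ! j + 1 \<longrightarrow>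
        3 dvd ((a # b # xs) ! j + (a # b # xs) ! (j + 1))) \<longleftrightarrow>
      (b \<le> a + 1 \<longrightarrow> 3 dvd (a + b)) \<and>
      (\<forall>j. j + 1 < length (b # xs) \<longrightarrow> (b # xs) ! (j + 1) \<le> (b # xs) ! j + 1 \<longrightarrow>
        3 dvd ((b # xs) ! j + (b # xs) ! (j + 1)))"
    by (subst all_nat_Suc) simp
  have s: "sorted (a # b # xs) \<longleftrightarrow> a \<le> b \<and> sorted (b # xs)"
    by auto
  show ?case
    unfolding d g s kr1_list.simps(3) 3 by blast
qed (simp_all add: diff_at_distance_def)

definition kr1_above :: "nat \<Rightarrow> nat list set" where
  "kr1_above i = {xs. kr1_list xs \<and> (\<forall>a\<in>set xs. i < a)}"

lemma kr1_list_Cons_sorted: "kr1_list (a # xs) \<Longrightarrow> \<forall>b\<in>set xs. a \<le> b"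
  using kr1_list_iff_conditions[of "a # xs"] by simp

lemma Nil_in_kr1_above: "[] \<in> kr1_above i"
  by (simp add: kr1_above_def)

lemma Cons_in_kr1_above: "a # xs \<in> kr1_above i \<longleftrightarrow> i < a \<and> kr1_list (a # xs)"
  using kr1_list_Cons_sorted[of a xs] by (fastforce simp: kr1_above_def)

lemma kr1_above_iff_hd: "xs \<in> kr1_above i \<longleftrightarrow> kr1_list xs \<and> (xs \<noteq> [] \<longrightarrow> i < hd xs)"
  by (cases xs) (auto simp: Nil_in_kr1_above Cons_in_kr1_above)

text \<open>
  The next three lemmas say what may follow a part \<open>1\<close>, \<open>2\<close> or \<open>3\<close>. By the divisibility
  condition, the only successors at distance at most one are \<open>2\<close> after \<open>1\<close> and \<open>3\<close> after
  \<open>3\<close>. If the successor exceeds \<open>3\<close>, the condition at distance two follows from the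
  admissibility of the tail.
\<close>
lemma kr1_list_Cons_2_iff: "kr1_list (2 # ys) \<longleftrightarrow> ys \<in> kr1_above 3"
proof (cases ys)
  case (Cons b zs)
  have b: "2 \<le> b \<and> (b \<le> 2 + 1 \<longrightarrow> 3 dvd 2 + b) \<longleftrightarrow> 3 < b"
    by presburger
  \<comment> \<open>A third part below \<open>5\<close> would make the second and third both \<open>4\<close>, with sum \<open>8\<close>.\<close>
  have c: "hd zs \<ge> 2 + 3" if "3 < b" "kr1_list (b # zs)" "zs \<noteq> []"
  proof (cases zs)
    case (Cons c us)
    then have "b \<le> c" "c \<le> b + 1 \<longrightarrow> 3 dvd b + c"
      using that by auto
    then show ?thesis
      using that(1) Cons by simp presburger
  qed (use that in simp)
  show ?thesis
    unfolding Cons kr1_list.simps Cons_in_kr1_above using b c by blast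
qed (simp add: Nil_in_kr1_above)

lemma kr1_list_Cons_3_iff:
  "kr1_list (3 # ys) \<longleftrightarrow> ys \<in> kr1_above 4 \<or> (\<exists>zs\<in>kr1_above 5. ys = 3 # zs)"
proof (cases ys)
  case (Cons b zs)
  have b: "3 \<le> b \<and> (b \<le> 3 + 1 \<longrightarrow> 3 dvd 3 + b) \<longleftrightarrow> b = 3 \<or> 4 < b"
    by presburger
  \<comment> \<open>A third part below \<open>6\<close> would make the second and third both \<open>5\<close>, with sum \<open>10\<close>.\<close>
  have c: "hd zs \<ge> 3 + 3" if "4 < b" "kr1_list (b # zs)" "zs \<noteq> []"
  proof (cases zs)
    case (Cons c us)
    then have "b \<le> c" "c \<le> b + 1 \<longrightarrow> 3 dvd b + c"
      using that by auto
    then show ?thesis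
      using that(1) Cons by simp presburger
  qed (use that in simp)
  \<comment> \<open>After the pair \<open>3, 3\<close> the distance-two condition already separates the second \<open>3\<close> from the rest.\<close>
  have d: "(zs \<noteq> [] \<longrightarrow> 3 + 3 \<le> hd zs) \<and> kr1_list (3 # zs) \<longleftrightarrow> zs \<in> kr1_above 5"
  proof (cases zs)
    case (Cons c us)
    show ?thesis
      using kr1_list_Cons_sorted[of c us]
      unfolding Cons Cons_in_kr1_above by (cases us) auto
  qed (simp add: Nil_in_kr1_above)
  show ?thesis
    unfolding Cons kr1_list.simps Cons_in_kr1_above list.inject using b c d by blast
qed (simp add: Nil_in_kr1_above)

lemma kr1_list_Cons_1_iff:
  "kr1_list (1 # ys) \<longleftrightarrow> ys \<in> kr1_above 3 \<or>
     (\<exists>zs\<in>kr1_above 3. ys = 2 # zs) \<or> (\<exists>zs\<in>kr1_above 4. ys = 3 # zs)"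
proof (cases ys)
  case (Cons b zs)
  have b: "1 \<le> b \<and> (b \<le> 1 + 1 \<longrightarrow> 3 dvd 1 + b) \<longleftrightarrow> b = 2 \<or> b = 3 \<or> 3 < b"
    by presburger
  have c: "hd zs \<ge> 1 + 3" if "3 < b" "kr1_list (b # zs)" "zs \<noteq> []"
    using kr1_list_Cons_sorted[OF that(2)] that(1,3) by (cases zs) auto
  have d: "(zs \<noteq> [] \<longrightarrow> 1 + 3 \<le> hd zs) \<and> kr1_list (2 # zs) \<longleftrightarrow> zs \<in> kr1_above 3"
    unfolding kr1_list_Cons_2_iff by (auto simp: kr1_above_iff_hd)
  \<comment> \<open>The distance-two condition forbids a second \<open>3\<close> after \<open>1, 3\<close>; this leaves only the first
    alternative for the tail of \<open>3\<close>.\<close>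
  have e: "(zs \<noteq> [] \<longrightarrow> 1 + 3 \<le> hd zs) \<and> kr1_list (3 # zs) \<longleftrightarrow> zs \<in> kr1_above 4"
    unfolding kr1_list_Cons_3_iff by (auto simp: kr1_above_iff_hd)
  show ?thesis
    unfolding Cons kr1_list.simps Cons_in_kr1_above list.inject using b c d e by blast
qed (simp add: Nil_in_kr1_above)

lemma kr1_above_Suc: "kr1_above i = kr1_above (Suc i) \<union> Cons (Suc i) ` {ys. kr1_list (Suc i # ys)}"
proof (rule set_eqI)
  show "xs \<in> kr1_above i \<longleftrightarrow> xs \<in> kr1_above (Suc i) \<union> Cons (Suc i) ` {ys. kr1_list (Suc i # ys)}" for xs
    by (cases xs; cases "hd xs = Suc i") (auto simp: Nil_in_kr1_above Cons_in_kr1_above)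
qed

lemma kr1_above_0:
  "kr1_above 0 = kr1_above 1 \<union> Cons 1 ` (kr1_above 3 \<union> Cons 2 ` kr1_above 3 \<union> Cons 3 ` kr1_above 4)"
proof -
  have "{ys. kr1_list (1 # ys)} = kr1_above 3 \<union> Cons 2 ` kr1_above 3 \<union> Cons 3 ` kr1_above 4"
    by (auto simp only: kr1_list_Cons_1_iff)
  then show ?thesis
    using kr1_above_Suc[of 0] by simp
qed

lemma kr1_above_1: "kr1_above 1 = kr1_above 2 \<union> Cons 2 ` kr1_above 3"
  using kr1_above_Suc[of 1] by (simp add: kr1_list_Cons_2_iff numeral_2_eq_2[symmetric])

lemma kr1_above_2: "kr1_above 2 = kr1_above 3 \<union> Cons 3 ` (kr1_above 4 \<union> Cons 3 ` kr1_above 5)"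
proof -
  have "{ys. kr1_list (3 # ys)} = kr1_above 4 \<union> Cons 3 ` kr1_above 5"
    by (auto simp only: kr1_list_Cons_3_iff)
  then show ?thesis
    using kr1_above_Suc[of 2] by simp
qed

lemma kr1_list_map_add_3: "kr1_list (map ((+) 3) xs) \<longleftrightarrow> kr1_list xs"
proof (induction xs rule: kr1_list.induct)
  case (3 a b xs)
  have "3 dvd ((3 + a) + (3 + b)) \<longleftrightarrow> 3 dvd (a + b)"
    by presburger
  with 3 show ?case
    by (cases xs) (auto simp: add.commute)
qed auto

lemma kr1_above_add_3: "kr1_above (i + 3) = map ((+) 3) ` kr1_above i"
proof (intro equalityI subsetI)
  fix xs assume xs: "xs \<in> kr1_above (i + 3)"
  then have "xs = map ((+) 3) (map (\<lambda>a. a - 3) xs)"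
    by (auto simp: kr1_above_def intro!: map_idI[symmetric])
  moreover from this xs have "map (\<lambda>a. a - 3) xs \<in> kr1_above i"
    using kr1_list_map_add_3[of "map (\<lambda>a. a - 3) xs"] by (auto simp: kr1_above_def)
  ultimately show "xs \<in> map ((+) 3) ` kr1_above i"
    by blast
qed (auto simp: kr1_above_def kr1_list_map_add_3)

section \<open>Generating functions of sets of lists\<close>

definition list_gf :: "nat list set \<Rightarrow> rat fps fps" where
  "list_gf A = Abs_fps (\<lambda>m. Abs_fps (\<lambda>n. of_nat (card {xs \<in> A. length xs = m \<and> sum_list xs = n})))"

abbreviation q_const :: "rat fps fps" where
  "q_const \<equiv> fps_const q_var"

text \<open>
  Fixing both length and sum leaves finitely many lists, so the cardinalities in \<open>list_gf A\<close> are
  genuine for every \<open>A\<close>.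
\<close>
lemma finite_lists_sum_length: "finite {xs :: nat list. length xs = m \<and> sum_list xs = n}"
proof (rule finite_subset)
  show "{xs. length xs = m \<and> sum_list xs = n} \<subseteq> {xs. set xs \<subseteq> {..n} \<and> length xs = m}"
    by (auto intro: member_le_sum_list)
qed (simp add: finite_lists_length_eq)

lemma list_gf_Un:
  assumes "A \<inter> B = {}"
  shows "list_gf (A \<union> B) = list_gf A + list_gf B"
proof -
  have "card {xs \<in> A \<union> B. length xs = m \<and> sum_list xs = n} =
      card {xs \<in> A. length xs = m \<and> sum_list xs = n} + card {xs \<in> B. length xs = m \<and> sum_list xs = n}" for m n
  proof -
    have fin: "finite {xs \<in> C. length xs = m \<and> sum_list xs = n}" for C
      by (rule finite_subset[OF _ finite_lists_sum_length[of m n]]) auto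
    have "{xs \<in> A \<union> B. length xs = m \<and> sum_list xs = n} =
        {xs \<in> A. length xs = m \<and> sum_list xs = n} \<union> {xs \<in> B. length xs = m \<and> sum_list xs = n}"
      by blast
    then show ?thesis
      using assms by (simp add: card_Un_disjoint[OF fin fin] disjoint_iff)
  qed
  then show ?thesis
    by (simp add: list_gf_def fps_eq_iff)
qed

lemma list_gf_Cons: "list_gf (Cons a ` A) = x_var * q_const ^ a * list_gf A"
proof -
  have "card {xs \<in> Cons a ` A. length xs = m \<and> sum_list xs = n} =
      (if m = 0 \<or> n < a then 0 else card {xs \<in> A. length xs = m - 1 \<and> sum_list xs = n - a})" for m n
  proof -
    have "{xs \<in> Cons a ` A. length xs = m \<and> sum_list xs = n} =
      (if m = 0 \<or> n < a then {} else Cons a ` {xs \<in> A. length xs = m - 1 \<and> sum_list xs = n - a})"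
      by auto
    then show ?thesis
      by (simp add: card_image)
  qed
  then show ?thesis
    by (simp add: list_gf_def fps_eq_iff fps_X_power_mult_nth mult.assoc fps_const_power)
qed

text \<open>The substitution of \<open>x q\<^sup>3\<close> for \<open>x\<close>.\<close>
definition dilate :: "rat fps fps \<Rightarrow> rat fps fps" where
  "dilate F = Abs_fps (\<lambda>m. q_var ^ (3 * m) * F $ m)"

lemma list_gf_map_add_3: "list_gf (map ((+) 3) ` A) = dilate (list_gf A)"
proof -
  have "card {xs \<in> map ((+) 3) ` A. length xs = m \<and> sum_list xs = n} =
      (if n < 3 * m then 0 else card {xs \<in> A. length xs = m \<and> sum_list xs = n - 3 * m})" for m n
  proof -
    have s: "sum_list (map ((+) 3) xs) = 3 * length xs + sum_list xs" for xs :: "nat list"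
      by (induction xs) auto
    have "{xs \<in> map ((+) 3) ` A. length xs = m \<and> sum_list xs = n} =
      (if n < 3 * m then {} else map ((+) 3) ` {xs \<in> A. length xs = m \<and> sum_list xs = n - 3 * m})"
      by (auto simp: s)
    moreover have "inj (map ((+) (3::nat)))"
      by simp
    ultimately show ?thesis
      by (simp add: card_image inj_on_subset[OF _ subset_UNIV])
  qed
  then show ?thesis
    by (simp add: list_gf_def dilate_def fps_eq_iff fps_X_power_mult_nth)
qed

lemma list_gf_kr1_above_add_3: "list_gf (kr1_above (i + 3)) = dilate (list_gf (kr1_above i))"
  by (simp add: kr1_above_add_3 list_gf_map_add_3)

section \<open>The system of functional equations\<close>

definition kr1_system :: "rat fps fps \<Rightarrow> rat fps fps \<Rightarrow> rat fps fps \<Rightarrow> bool" where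
  "kr1_system F0 F1 F2 \<longleftrightarrow>
     F0 = F1 + x_var * q_const * (dilate F0 + x_var * q_const ^ 2 * dilate F0 + x_var * q_const ^ 3 * dilate F1) \<and>
     F1 = F2 + x_var * q_const ^ 2 * dilate F0 \<and>
     F2 = dilate F0 + x_var * q_const ^ 3 * (dilate F1 + x_var * q_const ^ 3 * dilate F2)"

lemma kr1_system_list_gf:
  "kr1_system (list_gf (kr1_above 0)) (list_gf (kr1_above 1)) (list_gf (kr1_above 2))"
proof -
  have d: "Cons a ` A \<inter> Cons b ` B = {}" if "a \<noteq> b" for a b :: nat and A B
    using that by auto
  have e: "kr1_above i \<inter> Cons a ` B = {}" if "a \<le> i" for a i B
    using that by (auto simp: Cons_in_kr1_above)
  have shift: "list_gf (kr1_above 3) = dilate (list_gf (kr1_above 0))"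
      "list_gf (kr1_above 4) = dilate (list_gf (kr1_above 1))"
      "list_gf (kr1_above 5) = dilate (list_gf (kr1_above 2))"
    using list_gf_kr1_above_add_3[of 0] list_gf_kr1_above_add_3[of 1] list_gf_kr1_above_add_3[of 2]
    by simp_all
  show ?thesis
    unfolding kr1_system_def
  proof (intro conjI)
    have "(kr1_above 3 \<union> Cons 2 ` kr1_above 3) \<inter> Cons 3 ` kr1_above 4 = {}"
      by (auto simp: Cons_in_kr1_above)
    then show "list_gf (kr1_above 0) = list_gf (kr1_above 1) + x_var * q_const *
        (dilate (list_gf (kr1_above 0)) + x_var * q_const ^ 2 * dilate (list_gf (kr1_above 0)) +
         x_var * q_const ^ 3 * dilate (list_gf (kr1_above 1)))"
      by (subst kr1_above_0) (simp add: list_gf_Un list_gf_Cons d e shift)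
    show "list_gf (kr1_above 1) = list_gf (kr1_above 2) + x_var * q_const ^ 2 * dilate (list_gf (kr1_above 0))"
      by (subst kr1_above_1) (simp add: list_gf_Un list_gf_Cons d e shift)
    show "list_gf (kr1_above 2) = dilate (list_gf (kr1_above 0)) + x_var * q_const ^ 3 *
        (dilate (list_gf (kr1_above 1)) + x_var * q_const ^ 3 * dilate (list_gf (kr1_above 2)))"
      by (subst kr1_above_2) (simp add: list_gf_Un list_gf_Cons d e shift)
  qed
qed

text \<open>
  The difference of two solutions solves the same homogeneous system. If its coefficients below
  \<open>x\<^sup>m\<close> vanish, so do all terms of the system carrying a factor \<open>x\<close>, and the coefficient \<open>d\<close> of
  \<open>x\<^sup>m\<close> in the first component satisfies \<open>d = q\<^sup>3\<^sup>m d\<close>.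
\<close>
lemma kr1_system_unique:
  assumes F: "kr1_system F0 F1 F2" and G: "kr1_system G0 G1 G2" and const: "F0 $ 0 = G0 $ 0"
  shows "F0 = G0"
proof -
  define D0 D1 D2 where "D0 = F0 - G0" and "D1 = F1 - G1" and "D2 = F2 - G2"
  have dil: "dilate (A - B) = dilate A - dilate B" for A B
    by (simp add: dilate_def fps_eq_iff algebra_simps)
  have D: "kr1_system D0 D1 D2"
    unfolding kr1_system_def
  proof (intro conjI)
    note FG = F[unfolded kr1_system_def] G[unfolded kr1_system_def]
    show "D0 = D1 + x_var * q_const * (dilate D0 + x_var * q_const ^ 2 * dilate D0 + x_var * q_const ^ 3 * dilate D1)"
      unfolding D0_def D1_def dil
      using FG[THEN conjunct1] by algebra
    show "D1 = D2 + x_var * q_const ^ 2 * dilate D0"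
      unfolding D0_def D1_def D2_def dil
      using FG[THEN conjunct2, THEN conjunct1] by algebra
    show "D2 = dilate D0 + x_var * q_const ^ 3 * (dilate D1 + x_var * q_const ^ 3 * dilate D2)"
      unfolding D0_def D1_def D2_def dil
      using FG[THEN conjunct2, THEN conjunct2] by algebra
  qed
  have X: "(x_var * A) $ m = 0" if "\<And>k. k < m \<Longrightarrow> A $ k = 0" for A :: "rat fps fps" and m
    using that by (cases m) simp_all
  have "D0 $ m = 0 \<and> D1 $ m = 0 \<and> D2 $ m = 0" for m
  proof (induction m rule: less_induct)
    case (less m)
    have Z: "(x_var * (q_const ^ i * (dilate E))) $ m = 0"
        "(x_var * (q_const ^ i * (x_var * (q_const ^ j * (dilate E))))) $ m = 0"
      if "E \<in> {D0, D1, D2}" for E i j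
    proof -
      have "dilate E $ k = 0" if "k < m" for k
        using less.IH[OF that] \<open>E \<in> _\<close> by (auto simp: dilate_def)
      then show "(x_var * (q_const ^ i * (dilate E))) $ m = 0"
          "(x_var * (q_const ^ i * (x_var * (q_const ^ j * (dilate E))))) $ m = 0"
        by (auto intro!: X simp: fps_const_power)
    qed
    have "D0 = D1 + x_var * (q_const ^ 1 * dilate D0) + x_var * (q_const ^ 1 * (x_var * (q_const ^ 2 * dilate D0)))
          + x_var * (q_const ^ 1 * (x_var * (q_const ^ 3 * dilate D1)))"
      using D[unfolded kr1_system_def, THEN conjunct1] by algebra
    then have "D0 $ m = (D1 + x_var * (q_const ^ 1 * dilate D0) + x_var * (q_const ^ 1 * (x_var * (q_const ^ 2 * dilate D0)))
          + x_var * (q_const ^ 1 * (x_var * (q_const ^ 3 * dilate D1)))) $ m"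
      by (rule arg_cong)
    then have eq0: "D0 $ m = D1 $ m"
      unfolding fps_add_nth using Z(1)[of D0 1] Z(2)[of D0 1 2] Z(2)[of D1 1 3]
      by (simp only: insert_iff simp_thms add_0_right)
    have "D1 = D2 + x_var * (q_const ^ 2 * dilate D0)"
      using D[unfolded kr1_system_def, THEN conjunct2, THEN conjunct1] by algebra
    then have "D1 $ m = (D2 + x_var * (q_const ^ 2 * dilate D0)) $ m"
      by (rule arg_cong)
    then have eq1: "D1 $ m = D2 $ m"
      unfolding fps_add_nth using Z(1)[of D0 2]
      by (simp only: insert_iff simp_thms add_0_right)
    have "D2 = dilate D0 + x_var * (q_const ^ 3 * dilate D1) + x_var * (q_const ^ 3 * (x_var * (q_const ^ 3 * dilate D2)))"
      using D[unfolded kr1_system_def, THEN conjunct2, THEN conjunct2] by algebra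
    then have "D2 $ m = (dilate D0 + x_var * (q_const ^ 3 * dilate D1) + x_var * (q_const ^ 3 * (x_var * (q_const ^ 3 * dilate D2)))) $ m"
      by (rule arg_cong)
    then have eq2: "D2 $ m = dilate D0 $ m"
      unfolding fps_add_nth using Z(1)[of D1 3] Z(2)[of D2 3 3]
      by (simp only: insert_iff simp_thms add_0_right)
    note eq = eq0 eq1 eq2
    have "D0 $ m = q_var ^ (3 * m) * D0 $ m"
      using eq by (simp add: dilate_def)
    moreover have "q_var ^ (3 * m) \<noteq> 1" if "m > 0"
    proof
      assume "q_var ^ (3 * m) = 1"
      then have "(q_var ^ (3 * m)) $ 0 = 1 $ 0"
        by (rule arg_cong)
      with that show False
        by (simp add: fps_X_power_nth)
    qed
    moreover have "D0 $ 0 = 0"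
      using const by (simp add: D0_def)
    ultimately have "D0 $ m = 0"
      by (cases "m = 0") auto
    with eq show ?case
      by simp
  qed
  then show ?thesis
    by (simp add: D0_def fps_eq_iff)
qed

section \<open>The double series\<close>

text \<open>
  The linear terms \<open>a n\<^sub>1 + b n\<^sub>2\<close> make the family closed under dilation and under shifts of
  the summation indices.
\<close>
definition kr1_coeff :: "nat \<Rightarrow> nat \<Rightarrow> nat \<Rightarrow> nat \<Rightarrow> rat fps" where
  "kr1_coeff a b n1 n2 = q_var ^ (3 * n2\<^sup>2 + n1\<^sup>2 + 3 * n1 * n2 + a * n1 + b * n2) *
     inverse (qpochhammer q_var q_var n1 * qpochhammer (q_var ^ 3) (q_var ^ 3) n2)"

definition kr1_series :: "nat \<Rightarrow> nat \<Rightarrow> rat fps fps" where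
  "kr1_series a b = Abs_fps (\<lambda>m. \<Sum>(n1, n2) | 2 * n2 + n1 = m. kr1_coeff a b n1 n2)"

lemma finite_index: "finite {(n1 :: nat, n2 :: nat). 2 * n2 + n1 = m}"
  by (rule finite_subset[of _ "{..m} \<times> {..m}"]) auto

lemma qpochhammer_Suc: "qpochhammer a q (Suc n) = qpochhammer a q n * (1 - a * q ^ n)"
  by (simp add: qpochhammer_def)

text \<open>
  The two positions of \<open>v\<close> are those of the last inverted factor of the first and of the second
  Pochhammer symbol.
\<close>
lemma cancel_unit_factor:
  fixes u v :: "'a :: comm_ring_1"
  assumes "v * u = 1"
  shows "u * (x * y * (p * v * r)) = x * (y * (p * r))" "u * (x * y * (p * (r * v))) = x * (y * (p * r))"
proof -
  have "u * (x * y * (p * v * r)) = v * u * (x * (y * (p * r)))"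
    "u * (x * y * (p * (r * v))) = v * u * (x * (y * (p * r)))"
    by (simp_all only: ac_simps)
  with assms show "u * (x * y * (p * v * r)) = x * (y * (p * r))"
    "u * (x * y * (p * (r * v))) = x * (y * (p * r))"
    by simp_all
qed

text \<open>
  The factor on the left cancels the last factor of the Pochhammer symbol. On the exponent, raising
  an index changes the quadratic form by a linear one, which is absorbed into \<open>a\<close> and \<open>b\<close>.
\<close>
lemma kr1_coeff_Suc_1:
  "(1 - q_var ^ Suc n1) * kr1_coeff a b (Suc n1) n2 = q_var ^ Suc a * kr1_coeff (a + 2) (b + 3) n1 n2"
proof -
  have u: "inverse (1 - q_var * q_var ^ n1) * (1 - q_var * q_var ^ n1) = 1"
    by (rule inverse_mult_eq_1) simp
  have "3 * n2\<^sup>2 + (Suc n1)\<^sup>2 + 3 * Suc n1 * n2 + a * Suc n1 + b * n2 =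
      Suc a + (3 * n2\<^sup>2 + n1\<^sup>2 + 3 * n1 * n2 + (a + 2) * n1 + (b + 3) * n2)"
    by (simp add: power2_eq_square algebra_simps)
  then have e: "q_var ^ (3 * n2\<^sup>2 + (Suc n1)\<^sup>2 + 3 * Suc n1 * n2 + a * Suc n1 + b * n2) =
      q_var ^ Suc a * q_var ^ (3 * n2\<^sup>2 + n1\<^sup>2 + 3 * n1 * n2 + (a + 2) * n1 + (b + 3) * n2)"
    by (simp only: power_add)
  show ?thesis
    unfolding kr1_coeff_def e qpochhammer_Suc fps_inverse_mult power_Suc[of _ n1]
    by (rule cancel_unit_factor(1)[OF u])
qed

lemma kr1_coeff_Suc_2:
  "(1 - q_var ^ (3 * Suc n2)) * kr1_coeff a b n1 (Suc n2) =
     q_var ^ (b + 3) * kr1_coeff (a + 3) (b + 6) n1 n2"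
proof -
  have u: "inverse (1 - q_var ^ 3 * (q_var ^ 3) ^ n2) * (1 - q_var ^ 3 * (q_var ^ 3) ^ n2) = 1"
    by (rule inverse_mult_eq_1) simp
  have p: "q_var ^ (3 * Suc n2) = q_var ^ 3 * (q_var ^ 3) ^ n2"
    by (simp only: power_mult power_Suc)
  have "3 * (Suc n2)\<^sup>2 + n1\<^sup>2 + 3 * n1 * Suc n2 + a * n1 + b * Suc n2 =
      (b + 3) + (3 * n2\<^sup>2 + n1\<^sup>2 + 3 * n1 * n2 + (a + 3) * n1 + (b + 6) * n2)"
    by (simp add: power2_eq_square algebra_simps)
  then have e: "q_var ^ (3 * (Suc n2)\<^sup>2 + n1\<^sup>2 + 3 * n1 * Suc n2 + a * n1 + b * Suc n2) =
      q_var ^ (b + 3) * q_var ^ (3 * n2\<^sup>2 + n1\<^sup>2 + 3 * n1 * n2 + (a + 3) * n1 + (b + 6) * n2)"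
    by (simp only: power_add)
  show ?thesis
    unfolding kr1_coeff_def e p qpochhammer_Suc fps_inverse_mult
    by (rule cancel_unit_factor(2)[OF u])
qed

text \<open>
  In the termwise difference, the factor \<open>1 - q^n\<^sub>1\<close> kills the terms with \<open>n\<^sub>1 = 0\<close>; for the others the
  index shift applies and costs one factor \<open>x\<close>.
\<close>
lemma kr1_series_1:
  "kr1_series a b = kr1_series (Suc a) b + x_var * q_const ^ Suc a * kr1_series (a + 2) (b + 3)"
proof (rule fps_ext)
  fix m
  let ?I = "\<lambda>m. {(n1, n2). 2 * n2 + n1 = m} :: (nat \<times> nat) set"
  have shift: "kr1_coeff a b n1 n2 - kr1_coeff (Suc a) b n1 n2 = (1 - q_var ^ n1) * kr1_coeff a b n1 n2" for n1 n2
    by (simp add: kr1_coeff_def power_add algebra_simps)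
  have "kr1_series a b $ m - kr1_series (Suc a) b $ m = (\<Sum>(n1, n2)\<in>?I m. (1 - q_var ^ n1) * kr1_coeff a b n1 n2)"
    by (simp add: kr1_series_def case_prod_unfold shift flip: sum_subtractf)
  also have "\<dots> = (\<Sum>(n1, n2) \<in> {p \<in> ?I m. fst p \<noteq> 0}. (1 - q_var ^ n1) * kr1_coeff a b n1 n2)"
  proof (rule sum.mono_neutral_right[OF finite_index])
    show "\<forall>p \<in> ?I m - {p \<in> ?I m. fst p \<noteq> 0}. (case p of (n1, n2) \<Rightarrow> (1 - q_var ^ n1) * kr1_coeff a b n1 n2) = 0"
    proof
      fix p
      assume "p \<in> ?I m - {p \<in> ?I m. fst p \<noteq> 0}"
      then have "fst p = 0"
        by blast
      then show "(case p of (n1, n2) \<Rightarrow> (1 - q_var ^ n1) * kr1_coeff a b n1 n2) = 0"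
        by (simp add: case_prod_unfold)
    qed
  qed auto
  also have "\<dots> = (if m = 0 then 0 else \<Sum>(n1, n2) \<in> ?I (m - 1). (1 - q_var ^ Suc n1) * kr1_coeff a b (Suc n1) n2)"
  proof (cases m)
    case (Suc k)
    show ?thesis unfolding Suc
      by (simp del: power_Suc, rule sum.reindex_bij_witness[of _ "\<lambda>(n1, n2). (Suc n1, n2)" "\<lambda>(n1, n2). (n1 - 1, n2)"])
        (auto simp del: power_Suc)
  qed (auto intro: sum.neutral)
  also have "\<dots> = (x_var * q_const ^ Suc a * kr1_series (a + 2) (b + 3)) $ m"
    unfolding kr1_coeff_Suc_1
    by (simp add: kr1_series_def mult.assoc fps_const_power sum_distrib_left case_prod_unfold del: power_Suc)
  finally show "kr1_series a b $ m = (kr1_series (Suc a) b + x_var * q_const ^ Suc a * kr1_series (a + 2) (b + 3)) $ m"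
    by (simp add: algebra_simps)
qed

text \<open>The analogue for \<open>n\<^sub>2\<close>, where the index shift costs a factor \<open>x\<^sup>2\<close>.\<close>
lemma kr1_series_2:
  "kr1_series a b = kr1_series a (b + 3) + x_var ^ 2 * q_const ^ (b + 3) * kr1_series (a + 3) (b + 6)"
proof (rule fps_ext)
  fix m
  let ?I = "\<lambda>m. {(n1, n2). 2 * n2 + n1 = m} :: (nat \<times> nat) set"
  have shift: "kr1_coeff a b n1 n2 - kr1_coeff a (b + 3) n1 n2 = (1 - q_var ^ (3 * n2)) * kr1_coeff a b n1 n2" for n1 n2
    by (simp add: kr1_coeff_def power_add algebra_simps)
  have "kr1_series a b $ m - kr1_series a (b + 3) $ m = (\<Sum>(n1, n2)\<in>?I m. (1 - q_var ^ (3 * n2)) * kr1_coeff a b n1 n2)"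
    by (simp add: kr1_series_def case_prod_unfold shift flip: sum_subtractf)
  also have "\<dots> = (\<Sum>(n1, n2) \<in> {p \<in> ?I m. snd p \<noteq> 0}. (1 - q_var ^ (3 * n2)) * kr1_coeff a b n1 n2)"
  proof (rule sum.mono_neutral_right[OF finite_index])
    show "\<forall>p \<in> ?I m - {p \<in> ?I m. snd p \<noteq> 0}. (case p of (n1, n2) \<Rightarrow> (1 - q_var ^ (3 * n2)) * kr1_coeff a b n1 n2) = 0"
    proof
      fix p
      assume "p \<in> ?I m - {p \<in> ?I m. snd p \<noteq> 0}"
      then have "snd p = 0"
        by blast
      then show "(case p of (n1, n2) \<Rightarrow> (1 - q_var ^ (3 * n2)) * kr1_coeff a b n1 n2) = 0"
        by (simp add: case_prod_unfold)
    qed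
  qed auto
  also have "\<dots> = (if m < 2 then 0 else \<Sum>(n1, n2) \<in> ?I (m - 2). (1 - q_var ^ (3 * Suc n2)) * kr1_coeff a b n1 (Suc n2))"
  proof (cases "m < 2")
    case False
    have "(\<Sum>(n1, n2) \<in> {p \<in> ?I m. snd p \<noteq> 0}. (1 - q_var ^ (3 * n2)) * kr1_coeff a b n1 n2) =
        (\<Sum>(n1, n2) \<in> ?I (m - 2). (1 - q_var ^ (3 * Suc n2)) * kr1_coeff a b n1 (Suc n2))"
      using False
      by (intro sum.reindex_bij_witness[of _ "\<lambda>(n1, n2). (n1, Suc n2)" "\<lambda>(n1, n2). (n1, n2 - 1)"]) auto
    then show ?thesis using False by simp
  qed (auto intro!: sum.neutral)
  also have "\<dots> = (x_var ^ 2 * q_const ^ (b + 3) * kr1_series (a + 3) (b + 6)) $ m"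
    unfolding kr1_coeff_Suc_2
    by (simp add: kr1_series_def mult.assoc fps_const_power fps_X_power_mult_nth sum_distrib_left case_prod_unfold)
  finally show "kr1_series a b $ m = (kr1_series a (b + 3) + x_var ^ 2 * q_const ^ (b + 3) * kr1_series (a + 3) (b + 6)) $ m"
    by (simp add: algebra_simps)
qed

lemma dilate_kr1_series: "dilate (kr1_series a b) = kr1_series (a + 3) (b + 6)"
proof (rule fps_ext)
  fix m
  have "q_var ^ (3 * m) * kr1_coeff a b n1 n2 = kr1_coeff (a + 3) (b + 6) n1 n2" if "2 * n2 + n1 = m" for n1 n2
    unfolding kr1_coeff_def mult.assoc[symmetric] power_add[symmetric] that[symmetric]
    by (simp add: algebra_simps)
  then show "dilate (kr1_series a b) $ m = kr1_series (a + 3) (b + 6) $ m"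
    by (auto simp: dilate_def kr1_series_def sum_distrib_left intro!: sum.cong)
qed

text \<open>
  Two of the equations need an intermediate series: \<open>S(0, 0)\<close> is compared with \<open>S(1, 3)\<close> through
  \<open>S(0, 3)\<close>, and \<open>S(2, 3)\<close> with \<open>S(3, 6)\<close> through \<open>S(2, 6)\<close>. The latter also expands the
  term \<open>S(2, 6)\<close> that arises in the first comparison.
\<close>
lemma kr1_system_kr1_series: "kr1_system (kr1_series 0 0) (kr1_series 1 3) (kr1_series 2 3)"
  using kr1_series_2[of 0 0] kr1_series_1[of 0 3] kr1_series_1[of 2 6]
    kr1_series_1[of 1 3] kr1_series_2[of 2 3]
  unfolding kr1_system_def dilate_kr1_series by (simp add: eval_nat_numeral algebra_simps)

section \<open>Convergence and the identity\<close>

text \<open>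
  Convergence in the metric of power series is eventual constancy of each coefficient, and the
  coefficient of \<open>x\<^sup>m\<close> is settled once a finite set of indices contains all terms of degree \<open>m\<close>.
\<close>
lemma fps_has_sum_monomials:
  fixes c :: "'i \<Rightarrow> 'a :: comm_ring_1"
  assumes fin: "\<And>m. finite {p. d p = m}"
  shows "((\<lambda>p. fps_const (c p) * fps_X ^ d p) has_sum Abs_fps (\<lambda>m. \<Sum>p | d p = m. c p)) UNIV"
  unfolding has_sum_def
proof (rule tendsto_fpsI)
  fix m
  have "sum (\<lambda>p. fps_const (c p) * fps_X ^ d p) Y $ m = (\<Sum>p | d p = m. c p)"
    if "finite Y" "{p. d p = m} \<subseteq> Y" for Y
  proof -
    have "sum (\<lambda>p. fps_const (c p) * fps_X ^ d p) Y $ m = (\<Sum>p\<in>Y. if d p = m then c p else 0)"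
      by (auto simp: fps_sum_nth fps_X_power_nth intro!: sum.cong)
    also have "\<dots> = (\<Sum>p | d p = m. c p)"
      using that by (simp add: sum.If_cases Int_absorb1)
    finally show ?thesis .
  qed
  then show "\<forall>\<^sub>F Y in finite_subsets_at_top UNIV. sum (\<lambda>p. fps_const (c p) * fps_X ^ d p) Y $ m =
      Abs_fps (\<lambda>m. \<Sum>p | d p = m. c p) $ m"
    unfolding eventually_finite_subsets_at_top using fin[of m] by auto
qed

lemma kr1_partitions_eq: "kr1_partitions n m = {xs \<in> kr1_above 0. length xs = m \<and> sum_list xs = n}"
  by (auto simp: kr1_partitions_def partitions_of_def kr1_above_def kr1_list_iff_conditions)

theorem theorem7:
  shows "((\<lambda>(n1, n2).
             fps_const (q_var ^ (3 * n2\<^sup>2 + n1\<^sup>2 + 3 * n1 * n2) /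
               (qpochhammer q_var q_var n1 * qpochhammer (q_var ^ 3) (q_var ^ 3) n2))
             * x_var ^ (2 * n2 + n1))
          has_sum Abs_fps (\<lambda>m. Abs_fps (\<lambda>n. of_nat (kr1 n m)))) (UNIV :: (nat \<times> nat) set)"
proof -
  have unit: "qpochhammer (q_var ^ Suc k) (q_var ^ Suc k) n $ 0 \<noteq> 0" for k n
    by (induction n) (simp_all add: qpochhammer_def fps_X_power_nth)
  have coeff: "q_var ^ (3 * n2\<^sup>2 + n1\<^sup>2 + 3 * n1 * n2) /
      (qpochhammer q_var q_var n1 * qpochhammer (q_var ^ 3) (q_var ^ 3) n2) = kr1_coeff 0 0 n1 n2" for n1 n2
    using unit[of 0 n1] unit[of 2 n2] by (simp add: kr1_coeff_def fps_divide_unit)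
  have "list_gf (kr1_above 0) $ 0 = kr1_series 0 0 $ 0"
  proof -
    have "{xs \<in> kr1_above 0. length xs = 0 \<and> sum_list xs = n} = (if n = 0 then {[]} else {})" for n
      by (auto simp: Nil_in_kr1_above)
    moreover have "{(n1 :: nat, n2 :: nat). 2 * n2 + n1 = 0} = {(0, 0)}"
      by auto
    ultimately show ?thesis
      by (simp add: list_gf_def kr1_series_def kr1_coeff_def qpochhammer_def fps_eq_iff)
  qed
  then have "list_gf (kr1_above 0) = kr1_series 0 0"
    by (rule kr1_system_unique[OF kr1_system_list_gf kr1_system_kr1_series])
  moreover have "((\<lambda>p. fps_const (kr1_coeff 0 0 (fst p) (snd p)) * x_var ^ (2 * snd p + fst p))
      has_sum kr1_series 0 0) UNIV"
    using fps_has_sum_monomials[of "\<lambda>(n1, n2). 2 * n2 + n1" "\<lambda>(n1, n2). kr1_coeff 0 0 n1 n2"] finite_index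
    by (simp add: kr1_series_def case_prod_unfold)
  ultimately show ?thesis
    by (simp add: coeff case_prod_unfold kr1_def kr1_partitions_eq list_gf_def)
qed

end
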